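(* Let $\mathcal{H}$ be a set of graphs and let $h$ be an integer such that, for each graph $H\in\mathcal{H}$, the complementary graph $\bar{H}$ has girth at most $h$. If the class of $\mathcal{H}$-free graphs is $\chi$-bounded, then its optimal $\chi$-binding function $f^\star_{\mathcal{H}}\colon\mathbb{N}_{>0}\to\mathbb{N}_{>0}$ cannot be bounded from above by a linear function.
   Context: All graphs are finite, simple and undirected. $\omega(G)$ and $\chi(G)$ are the clique number and the chromatic number of $G$. The girth of a graph is the length of a shortest cycle (infinite if the graph has no cycle), so girth at most $h$ means that there is a cycle of length at most $h$. A graph $G$ is $\mathcal{H}$-free if no induced subgraph of $G$ is isomorphic to a graph in $\mathcal{H}$. The class of $\mathcal{H}$-free graphs is $\chi$-bounded if there is a function $f\colon\mathbb{N}_{>0}\to\mathbb{N}_{>0}$ with $\chi(G)\le f(\omega(G))$ for every $\mathcal{H}$-free graph $G$ (with at least one vertex). In that case the optimal $\chi$-binding function is $f^\star_{\mathcal{H}}(\omega)=\max\{\chi(G): G \text{ is } \mathcal{H}\text{-free},\ \omega(G)=\omega\}$. *)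

theory Defs
  imports "Graph_Theory.Graph_Theory" "HOL-Library.Extended_Real"
begin

text \<open>
  A finite simple undirected graph is a symmetric loop-free digraph without parallel arcs, i.e.
  an instance of the locale \<open>pair_graph\<close>; an edge \<open>uv\<close> is the pair of arcs \<open>(u, v)\<close>, \<open>(v, u)\<close>.
\<close>

definition complement :: "'a pair_pre_digraph \<Rightarrow> 'a pair_pre_digraph" where
  "complement G = \<lparr>pverts = pverts G,
     parcs = {(u, v). u \<in> pverts G \<and> v \<in> pverts G \<and> u \<noteq> v \<and> (u, v) \<notin> parcs G}\<rparr>"

definition is_clique :: "'a pair_pre_digraph \<Rightarrow> 'a set \<Rightarrow> bool" where
  "is_clique G S \<longleftrightarrow> S \<subseteq> pverts G \<and> (\<forall>u\<in>S. \<forall>v\<in>S. u \<noteq> v \<longrightarrow> (u, v) \<in> parcs G)"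

definition clique_number :: "'a pair_pre_digraph \<Rightarrow> nat" where
  "clique_number G = Max {card S |S. is_clique G S}"

definition proper_coloring :: "'a pair_pre_digraph \<Rightarrow> nat \<Rightarrow> ('a \<Rightarrow> nat) \<Rightarrow> bool" where
  "proper_coloring G k c \<longleftrightarrow>
     (\<forall>v\<in>pverts G. c v < k) \<and> (\<forall>(u, v)\<in>parcs G. c u \<noteq> c v)"

definition chromatic_number :: "'a pair_pre_digraph \<Rightarrow> nat" where
  "chromatic_number G = (LEAST k. \<exists>c. proper_coloring G k c)"

text \<open>
  The library notion of a cycle also admits the closed walk \<open>u, v, u\<close> along a single edge of a
  symmetric digraph, which is not a cycle of the undirected graph; hence the bound on the length.
  If there are no cycles, the infimum is \<open>\<infinity>\<close>.
\<close>

definition girth :: "'a pair_pre_digraph \<Rightarrow> enat" where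
  "girth G = (INF p\<in>{p. pre_digraph.cycle (with_proj G) p \<and> 3 \<le> length p}. enat (length p))"

definition free_of :: "'b pair_pre_digraph set \<Rightarrow> 'a pair_pre_digraph \<Rightarrow> bool" where
  "free_of \<H> G \<longleftrightarrow>
     \<not> (\<exists>F. \<exists>H\<in>\<H>. induced_subgraph (with_proj F) (with_proj G) \<and>
                  digraph_iso (with_proj F) (with_proj H))"

text \<open>
  Every finite graph is isomorphic to one whose vertices are natural numbers, so the class of
  \<open>\<H>\<close>-free graphs is represented by its members on natural numbers. As clique number and
  chromatic number matter only for graphs with at least one vertex, the empty graph is left out.
\<close>

definition free_graphs :: "'b pair_pre_digraph set \<Rightarrow> nat pair_pre_digraph set" where
  "free_graphs \<H> = {G. pair_graph G \<and> pverts G \<noteq> {} \<and> free_of \<H> G}"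

definition chi_bounded :: "'a pair_pre_digraph set \<Rightarrow> bool" where
  "chi_bounded \<C> \<longleftrightarrow>
     (\<exists>f :: nat \<Rightarrow> nat. (\<forall>w>0. f w > 0) \<and>
        (\<forall>G\<in>\<C>. chromatic_number G \<le> f (clique_number G)))"

text \<open>
  The set below is finite if the class of \<open>\<H>\<close>-free graphs is \<open>\<chi>\<close>-bounded. For \<open>w > 0\<close> it is
  nonempty if \<open>\<H>\<close> contains no complete graph; only arguments \<open>w > 0\<close> are meaningful.
\<close>

definition opt_binding :: "'b pair_pre_digraph set \<Rightarrow> nat \<Rightarrow> nat" where
  "opt_binding \<H> w = Max {chromatic_number G |G. G \<in> free_graphs \<H> \<and> clique_number G = w}"

end

theory Submission
  imports Defs
begin

text \<open>
  Pass to complements. Let \<open>\<Gamma>\<close> be a finite graph without cycles of length at most \<open>max 3 h\<close>. The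
  complement \<open>G\<close> of \<open>\<Gamma>\<close> is \<open>\<H>\<close>-free: an induced copy of some \<open>H \<in> \<H>\<close> in \<open>G\<close> would put the
  complement of \<open>H\<close>, and with it a short cycle, into \<open>\<Gamma>\<close>. Cliques of \<open>G\<close> are independent sets
  of \<open>\<Gamma>\<close>, so \<open>\<omega>(G)\<close> is the independence number of \<open>\<Gamma>\<close>. Colour classes of \<open>G\<close> are cliques of
  the triangle-free graph \<open>\<Gamma>\<close> and have at most two elements, so \<open>\<chi>(G)\<close> is at least half the
  number of vertices. A linear bound on \<open>f\<^sup>\<star>\<close> would therefore bound the independence ratio of all
  such \<open>\<Gamma>\<close> with large independence number away from \<open>0\<close>.

  By a theorem of Erdos there is no such bound, even for arbitrarily large girth
  (\<open>large_girth_small_independence\<close>). The random graph behind it has constant average degree: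
  there are \<open>d q\<close> vertices and each pair is an edge with probability \<open>1/q\<close>. The expected number of
  cycles of length \<open>l\<close> is then at most \<open>d ^ l\<close>, which does not depend on \<open>q\<close>
  (\<open>sum_short_cycles_le\<close>), while the expected number of independent sets of size \<open>s\<close>, a small
  fixed fraction of the vertices, is at most \<open>1/2\<close> (\<open>sum_independent_sets_le\<close>). So for large \<open>q\<close>
  some graph has no independent set of size \<open>s\<close> and only few short cycles, which disappear when
  one vertex of each is deleted. Probability enters only as counting of labellings of the pairs
  by \<open>{..<q}\<close>, where the label \<open>0\<close> marks the edges.
\<close>

section \<open>Cycles and their edge sets\<close>

definition cycle_on :: "('a \<Rightarrow> 'a \<Rightarrow> bool) \<Rightarrow> 'a list \<Rightarrow> bool" where
  "cycle_on R xs \<longleftrightarrow> 3 \<le> length xs \<and> distinct xs \<and> successively R xs \<and> R (last xs) (hd xs)"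

text \<open>
  The set of edges, not the list of vertices, determines how likely a cycle is in the random graph.
\<close>

fun path_edges :: "'a list \<Rightarrow> 'a set set" where
  "path_edges (x # y # xs) = insert {x, y} (path_edges (y # xs))"
| "path_edges _ = {}"

definition cycle_edges :: "'a list \<Rightarrow> 'a set set" where
  "cycle_edges xs = insert {last xs, hd xs} (path_edges xs)"

lemma finite_path_edges: "finite (path_edges xs)"
  by (induction xs rule: path_edges.induct) auto

lemma path_edges_subset: "e \<in> path_edges xs \<Longrightarrow> e \<subseteq> set xs"
  by (induction xs rule: path_edges.induct) auto

lemma card_path_edges_elem: "distinct xs \<Longrightarrow> e \<in> path_edges xs \<Longrightarrow> card e = 2"
  by (induction xs rule: path_edges.induct) auto

lemma card_path_edges: "distinct xs \<Longrightarrow> card (path_edges xs) = length xs - 1"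
proof (induction xs rule: path_edges.induct)
  case (1 x y xs)
  have "{x, y} \<notin> path_edges (y # xs)"
    using path_edges_subset[of "{x, y}" "y # xs"] 1(2) by auto
  then show ?case using 1 by (simp add: finite_path_edges)
qed auto

text \<open>
  The closing edge is no path edge: the only path edge at the first vertex leads to the second
  one, which is not the last one. This fails for length \<open>2\<close>.
\<close>

lemma card_cycle_edges:
  assumes "distinct xs" "3 \<le> length xs"
  shows "card (cycle_edges xs) = length xs"
proof -
  obtain x y z zs where xs: "xs = x # y # z # zs"
    using assms(2) by (metis One_nat_def Suc_le_length_iff numeral_3_eq_3)
  have "{last xs, x} \<notin> path_edges (y # z # zs)"
    using path_edges_subset[of "{last xs, x}" "y # z # zs"] assms(1) xs by auto
  moreover have "last xs \<in> set (z # zs)" unfolding xs by simp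
  then have "{last xs, x} \<noteq> {x, y}"
    using assms(1) unfolding xs by (auto simp: doubleton_eq_iff)
  ultimately have "{last xs, x} \<notin> path_edges xs" unfolding xs by simp
  then show ?thesis
    using card_path_edges[OF assms(1)] finite_path_edges[of xs] assms(2)
    unfolding cycle_edges_def by (simp add: xs)
qed

lemma cycle_edges_subset_pairs:
  assumes "distinct xs" "3 \<le> length xs" "set xs \<subseteq> V"
  shows "cycle_edges xs \<subseteq> {e. e \<subseteq> V \<and> card e = 2}"
proof -
  obtain x y ys where xs: "xs = x # y # ys"
    using assms(2) by (metis Suc_le_length_iff numeral_3_eq_3)
  have "last xs \<in> set (y # ys)" unfolding xs by simp
  then have "last xs \<noteq> x" "last xs \<in> set xs" using assms(1) unfolding xs by auto
  then have "{last xs, hd xs} \<subseteq> V \<and> card {last xs, hd xs} = 2"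
    using assms(3) xs by auto
  then show ?thesis
    using path_edges_subset[of _ xs] card_path_edges_elem[OF assms(1)] assms(3)
    unfolding cycle_edges_def by blast
qed

lemma cycle_edges_if_cycle_on:
  assumes "cycle_on (\<lambda>u v. {u, v} \<in> Z) xs"
  shows "cycle_edges xs \<subseteq> Z"
proof -
  have "successively (\<lambda>u v. {u, v} \<in> Z) ys \<Longrightarrow> path_edges ys \<subseteq> Z" for ys
    by (induction ys rule: path_edges.induct) auto
  then show ?thesis using assms unfolding cycle_on_def cycle_edges_def by auto
qed

section \<open>Counting labellings of pairs\<close>

lemma sum_card_swap:
  assumes "finite A" "finite B"
  shows "(\<Sum>a\<in>A. card {b\<in>B. P a b}) = (\<Sum>b\<in>B. card {a\<in>A. P a b})"
proof -
  have "(\<Sum>a\<in>A. card {b\<in>B. P a b}) = (\<Sum>a\<in>A. \<Sum>b\<in>B. if P a b then 1 else 0)"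
    using assms(2) by (simp add: sum.If_cases Int_def)
  also have "\<dots> = (\<Sum>b\<in>B. \<Sum>a\<in>A. if P a b then 1 else 0)" by (rule sum.swap)
  also have "\<dots> = (\<Sum>b\<in>B. card {a\<in>A. P a b})"
    using assms(1) by (simp add: sum.If_cases Int_def)
  finally show ?thesis .
qed

text \<open>
  Labels are independent and uniform. The case \<open>Y = {0}\<close> says that all of \<open>A\<close> are edges, the case
  \<open>Y = {1..<q}\<close> that none is.
\<close>

lemma card_labellings_restricted:
  assumes "finite E" "A \<subseteq> E" "Y \<subseteq> X"
  shows "card {f \<in> E \<rightarrow>\<^sub>E X. \<forall>e\<in>A. f e \<in> Y} = card Y ^ card A * card X ^ (card E - card A)"
proof -
  have "{f \<in> E \<rightarrow>\<^sub>E X. \<forall>e\<in>A. f e \<in> Y} = (\<Pi>\<^sub>E e\<in>E. if e \<in> A then Y else X)"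
    using assms(2,3) by (fastforce simp: PiE_iff split: if_splits)
  then have "card {f \<in> E \<rightarrow>\<^sub>E X. \<forall>e\<in>A. f e \<in> Y} = (\<Prod>e\<in>E. card (if e \<in> A then Y else X))"
    using assms(1) by (simp add: card_PiE)
  also have "\<dots> = (\<Prod>e\<in>E. if e \<in> A then card Y else card X)"
    by (intro prod.cong) auto
  also have "\<dots> = card Y ^ card (E \<inter> A) * card X ^ card (E - A)"
    using assms(1) by (simp add: prod.If_cases Diff_eq)
  also have "E \<inter> A = A" using assms(2) by auto
  also have "card (E - A) = card E - card A"
    using assms(1,2) by (simp add: card_Diff_subset finite_subset)
  finally show ?thesis .
qed

text \<open>
  This is \<open>(1 - 1/q) ^ q \<le> 1/2\<close> without division: the first two terms of the binomial expansion of
  \<open>((q - 1) + 1) ^ q\<close> already give the bound.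
\<close>

lemma two_mult_pred_power_le:
  assumes "0 < q"
  shows "2 * (q - 1) ^ q \<le> (q :: nat) ^ q"
proof -
  obtain p where q: "q = Suc p" using assms gr0_conv_Suc by auto
  have "p ^ i + i * p ^ (i - 1) \<le> Suc p ^ i" for i
  proof (induction i)
    case (Suc i)
    have "p ^ Suc i + Suc i * p ^ i \<le> Suc p * (p ^ i + i * p ^ (i - 1))"
      by (cases i) (auto simp: algebra_simps)
    also have "\<dots> \<le> Suc p * Suc p ^ i" using Suc by (rule mult_le_mono2)
    finally show ?case by simp
  qed simp
  from this[of q] show ?thesis unfolding q by (simp add: algebra_simps)
qed

lemma pow2_mult_pred_power_le:
  assumes "0 < q" "q * i \<le> m"
  shows "2 ^ i * (q - 1) ^ m \<le> (q :: nat) ^ m"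
proof -
  have "2 ^ i * (q - 1) ^ (q * i) = (2 * (q - 1) ^ q) ^ i"
    by (simp add: power_mult power_mult_distrib)
  also have "\<dots> \<le> (q ^ q) ^ i"
    by (rule power_mono[OF two_mult_pred_power_le[OF assms(1)]]) simp
  also have "\<dots> = q ^ (q * i)" by (simp add: power_mult)
  finally have "2 ^ i * (q - 1) ^ (q * i) * (q - 1) ^ (m - q * i) \<le> q ^ (q * i) * q ^ (m - q * i)"
    by (intro mult_le_mono) (auto intro: power_mono)
  then show ?thesis
    using assms(2) by (simp add: mult.assoc flip: power_add)
qed

text \<open>
  There are at most \<open>(d q) ^ l\<close> vertex sequences of length \<open>l\<close>, and a cyclic sequence of distinct
  vertices has \<open>l\<close> edges, so it is a cycle for a fraction \<open>1 / q ^ l\<close> of all labellings.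
\<close>

lemma sum_short_cycles_le:
  fixes V :: "'a set" and q k d :: nat
  defines "E \<equiv> {e. e \<subseteq> V \<and> card e = 2}"
  assumes "finite V" "card V = d * q"  "0 < q"
  shows "(\<Sum>f\<in>E \<rightarrow>\<^sub>E {..<q}. card {xs. set xs \<subseteq> V \<and> 3 \<le> length xs \<and> length xs \<le> k \<and>
            distinct xs \<and> (\<forall>e\<in>cycle_edges xs. f e = 0)})
          \<le> (\<Sum>l\<le>k. d ^ l) * q ^ card E"
proof -
  define C where "C l = {xs. set xs \<subseteq> V \<and> length xs = l \<and> 3 \<le> length xs \<and> distinct xs}" for l
  have finE: "finite E" using assms(2) unfolding E_def by simp
  have finO: "finite (E \<rightarrow>\<^sub>E {..<q})" using finE by (simp add: finite_PiE)
  have finL: "finite {xs. set xs \<subseteq> V \<and> length xs = l}" for l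
    using assms(2) by (rule finite_lists_length_eq)
  have finC: "finite (C l)" for l
    by (rule finite_subset[OF _ finL[of l]]) (auto simp: C_def)
  have cardC: "card (C l) \<le> (d * q) ^ l" for l
    using card_mono[OF finL[of l], of "C l"] card_lists_length_eq[OF assms(2), of l] assms(3)
    by (auto simp: C_def)
  have each: "card {f \<in> E \<rightarrow>\<^sub>E {..<q}. \<forall>e\<in>cycle_edges xs. f e = 0} * q ^ l = q ^ card E"
    if "xs \<in> C l" for xs l
  proof -
    have sub: "cycle_edges xs \<subseteq> E"
      using cycle_edges_subset_pairs[of xs V] that unfolding E_def C_def by auto
    have len: "card (cycle_edges xs) = l"
      using card_cycle_edges[of xs] that unfolding C_def by auto
    have "l \<le> card E" using card_mono[OF finE sub] len by simp
    then show ?thesis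
      using card_labellings_restricted[OF finE sub, of "{0}" "{..<q}"] len assms(4)
      by (simp flip: power_add)
  qed
  have "(\<Sum>f\<in>E \<rightarrow>\<^sub>E {..<q}. card {xs. set xs \<subseteq> V \<and> 3 \<le> length xs \<and> length xs \<le> k \<and>
            distinct xs \<and> (\<forall>e\<in>cycle_edges xs. f e = 0)})
        = (\<Sum>f\<in>E \<rightarrow>\<^sub>E {..<q}. card {xs \<in> (\<Union>l\<le>k. C l). \<forall>e\<in>cycle_edges xs. f e = 0})"
    by (intro sum.cong refl arg_cong[of _ _ card]) (auto simp: C_def)
  also have "\<dots> = (\<Sum>xs\<in>(\<Union>l\<le>k. C l). card {f \<in> E \<rightarrow>\<^sub>E {..<q}. \<forall>e\<in>cycle_edges xs. f e = 0})"
    using finO finC by (intro sum_card_swap) auto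
  also have "\<dots> = (\<Sum>l\<le>k. \<Sum>xs\<in>C l. card {f \<in> E \<rightarrow>\<^sub>E {..<q}. \<forall>e\<in>cycle_edges xs. f e = 0})"
    using finC by (intro sum.UNION_disjoint) (auto simp: C_def)
  also have "\<dots> \<le> (\<Sum>l\<le>k. d ^ l * q ^ card E)"
  proof (rule sum_mono)
    fix l
    have "(\<Sum>xs\<in>C l. card {f \<in> E \<rightarrow>\<^sub>E {..<q}. \<forall>e\<in>cycle_edges xs. f e = 0}) * q ^ l
          = card (C l) * q ^ card E"
      using each[of _ l] by (simp add: sum_distrib_right)
    also have "\<dots> \<le> (d * q) ^ l * q ^ card E" using cardC by (rule mult_le_mono1)
    also have "\<dots> = d ^ l * q ^ card E * q ^ l" by (simp add: power_mult_distrib)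
    finally show "(\<Sum>xs\<in>C l. card {f \<in> E \<rightarrow>\<^sub>E {..<q}. \<forall>e\<in>cycle_edges xs. f e = 0})
                  \<le> d ^ l * q ^ card E"
      using assms(4) by simp
  qed
  finally show ?thesis by (simp add: sum_distrib_right)
qed

text \<open>
  Union bound over all sets of size \<open>s\<close>. One of them is independent for a fraction
  \<open>(1 - 1/q) ^ (s choose 2)\<close> of the labellings. This beats \<open>2 ^ (card V)\<close>, a bound on the number
  of these sets, once \<open>s choose 2\<close> is at least \<open>q\<close> times the exponent.
\<close>

lemma sum_independent_sets_le:
  fixes V :: "'a set" and q s :: nat
  defines "E \<equiv> {e. e \<subseteq> V \<and> card e = 2}"
  assumes "finite V" "0 < q" "q * (card V + 1) \<le> s choose 2"
  shows "2 * (\<Sum>f\<in>E \<rightarrow>\<^sub>E {..<q}. card {S. S \<subseteq> V \<and> card S = s \<and> (\<forall>e\<in>E. e \<subseteq> S \<longrightarrow> f e \<noteq> 0)})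
          \<le> q ^ card E"
proof -
  define I where "I = {S. S \<subseteq> V \<and> card S = s}"
  have finE: "finite E" using assms(2) unfolding E_def by simp
  have finO: "finite (E \<rightarrow>\<^sub>E {..<q})" using finE by (simp add: finite_PiE)
  have finI: "finite I" using assms(2) unfolding I_def by simp
  have cardI: "card I \<le> 2 ^ card V"
    using card_mono[of "Pow V" I] assms(2) by (auto simp: I_def card_Pow)
  have each: "2 ^ (card V + 1) * card {f \<in> E \<rightarrow>\<^sub>E {..<q}. \<forall>e\<in>E. e \<subseteq> S \<longrightarrow> f e \<noteq> 0} \<le> q ^ card E"
    if "S \<in> I" for S
  proof -
    define A where "A = {e. e \<subseteq> S \<and> card e = 2}"
    have sub: "A \<subseteq> E" using that unfolding A_def E_def I_def by auto
    have cardA: "card A = s choose 2"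
      using n_subsets[of S 2] that assms(2) finite_subset unfolding A_def I_def by auto
    have le: "s choose 2 \<le> card E" using card_mono[OF finE sub] cardA by simp
    have "(\<forall>e\<in>E. e \<subseteq> S \<longrightarrow> f e \<noteq> 0) \<longleftrightarrow> (\<forall>e\<in>A. f e \<in> {1..<q})" if "f \<in> E \<rightarrow>\<^sub>E {..<q}" for f
    proof -
      have "A = {e\<in>E. e \<subseteq> S}" using sub by (auto simp: A_def E_def)
      moreover have "f e \<in> {1..<q} \<longleftrightarrow> f e \<noteq> 0" if "e \<in> E" for e
        using PiE_mem[OF \<open>f \<in> E \<rightarrow>\<^sub>E {..<q}\<close> that] by auto
      ultimately show ?thesis by auto
    qed
    then have "{f \<in> E \<rightarrow>\<^sub>E {..<q}. \<forall>e\<in>E. e \<subseteq> S \<longrightarrow> f e \<noteq> 0} =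
          {f \<in> E \<rightarrow>\<^sub>E {..<q}. \<forall>e\<in>A. f e \<in> {1..<q}}"
      by (rule Collect_cong[OF conj_cong[OF refl]])
    moreover have "{1..<q} \<subseteq> {..<q}" by auto
    ultimately have "card {f \<in> E \<rightarrow>\<^sub>E {..<q}. \<forall>e\<in>E. e \<subseteq> S \<longrightarrow> f e \<noteq> 0}
        = (q - 1) ^ (s choose 2) * q ^ (card E - (s choose 2))"
      using card_labellings_restricted[OF finE sub, of "{1..<q}" "{..<q}"] cardA by simp
    then have "2 ^ (card V + 1) * card {f \<in> E \<rightarrow>\<^sub>E {..<q}. \<forall>e\<in>E. e \<subseteq> S \<longrightarrow> f e \<noteq> 0} =
        (2 ^ (card V + 1) * (q - 1) ^ (s choose 2)) * q ^ (card E - (s choose 2))"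
      by (simp only: mult.assoc)
    also have "\<dots> \<le> q ^ (s choose 2) * q ^ (card E - (s choose 2))"
      by (intro mult_le_mono1 pow2_mult_pred_power_le assms)
    also have "\<dots> = q ^ card E" using le by (simp flip: power_add)
    finally show ?thesis .
  qed
  have "(\<Sum>f\<in>E \<rightarrow>\<^sub>E {..<q}. card {S. S \<subseteq> V \<and> card S = s \<and> (\<forall>e\<in>E. e \<subseteq> S \<longrightarrow> f e \<noteq> 0)})
      = (\<Sum>f\<in>E \<rightarrow>\<^sub>E {..<q}. card {S\<in>I. \<forall>e\<in>E. e \<subseteq> S \<longrightarrow> f e \<noteq> 0})"
    by (simp add: I_def conj_assoc)
  also have "\<dots> = (\<Sum>S\<in>I. card {f \<in> E \<rightarrow>\<^sub>E {..<q}. \<forall>e\<in>E. e \<subseteq> S \<longrightarrow> f e \<noteq> 0})"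
    by (rule sum_card_swap[OF finO finI])
  finally have "2 ^ (card V + 1) * (\<Sum>f\<in>E \<rightarrow>\<^sub>E {..<q}.
      card {S. S \<subseteq> V \<and> card S = s \<and> (\<forall>e\<in>E. e \<subseteq> S \<longrightarrow> f e \<noteq> 0)})
      = (\<Sum>S\<in>I. 2 ^ (card V + 1) * card {f \<in> E \<rightarrow>\<^sub>E {..<q}. \<forall>e\<in>E. e \<subseteq> S \<longrightarrow> f e \<noteq> 0})"
    by (simp only: sum_distrib_left)
  also have "\<dots> \<le> card I * q ^ card E"
    using sum_bounded_above[of I, OF each] by simp
  also have "\<dots> \<le> 2 ^ card V * q ^ card E" using cardI by (rule mult_le_mono1)
  finally show ?thesis by simp
qed

section \<open>Large girth and small independence number\<close>

text \<open>
  The deletion argument. The set \<open>Z\<close> of edges may contain pairs outside \<open>V\<close>: deleting vertices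
  does not change it. The factor \<open>c\<close> is reached by starting with \<open>Suc c * s\<close> vertices and deleting
  at most \<open>s\<close> of them.
\<close>

theorem large_girth_small_independence:
  fixes c k N :: nat
  obtains V :: "nat set" and Z :: "nat set set" and s :: nat
  where "finite V" "N \<le> s" "c * s \<le> card V" 
    and "\<And>e. e \<in> Z \<Longrightarrow> card e = 2"
    and "\<And>xs. set xs \<subseteq> V \<Longrightarrow> length xs \<le> k \<Longrightarrow> \<not> cycle_on (\<lambda>u v. {u, v} \<in> Z) xs"
    and "\<And>S. S \<subseteq> V \<Longrightarrow> \<forall>u\<in>S. \<forall>v\<in>S. {u, v} \<notin> Z \<Longrightarrow> card S < s"
proof -
  \<comment> \<open>With \<open>t q\<close> for \<open>s\<close> and \<open>Suc c * t * q\<close> vertices, both sides of \<open>q (card W + 1) \<le> s choose 2\<close>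
     are quadratic in \<open>q\<close>; the leading terms need \<open>t > 2 * Suc c\<close>, the rest pays for lower terms.
     Neither \<open>t\<close> nor the bound \<open>K\<close> on the expected number of cycles depends on \<open>q\<close>.\<close>
  define t where "t = 2 * Suc c + 3"
  define d where "d = Suc c * t"
  define K where "K = (\<Sum>l\<le>k. d ^ l)"
  define M where "M = 2 * K + 1"
  define q where "q = N + M"
  define s where "s = t * q"
  define W where "W = {..<d * q}"
  define E where "E = {e. e \<subseteq> W \<and> card e = 2}"
  define C where "C f = {xs. set xs \<subseteq> W \<and> 3 \<le> length xs \<and> length xs \<le> k \<and>
      distinct xs \<and> (\<forall>e\<in>cycle_edges xs. f e = (0::nat))}" for f
  define I where "I f = {S. S \<subseteq> W \<and> card S = s \<and> (\<forall>e\<in>E. e \<subseteq> S \<longrightarrow> f e \<noteq> (0::nat))}" for f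
  have q0: "0 < q" "M \<le> q" "N \<le> q" by (auto simp: q_def M_def)
  have W: "finite W" "card W = d * q" by (auto simp: W_def)
  have finE: "finite E" using W(1) unfolding E_def by simp
  have finO: "finite (E \<rightarrow>\<^sub>E {..<q})" using finE by (simp add: finite_PiE)
  have cardO: "card (E \<rightarrow>\<^sub>E {..<q}) = q ^ card E" using finE by (simp add: card_PiE)

  have "2 * (q * (card W + 1)) \<le> s * (s - 1)"
  proof -
    have "2 * (d * q + 1) \<le> t * (s - 1)"
    proof -
      have "s - 1 = 2 * Suc c * q + (3 * q - 1)"
        using q0(1) by (simp add: s_def t_def algebra_simps)
      then have "t * (s - 1) = 2 * (d * q) + t * (3 * q - 1)"
        by (simp add: d_def algebra_simps)
      moreover have "2 * 1 \<le> t * (3 * q - 1)"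
        using q0(1) by (intro mult_le_mono) (auto simp: t_def)
      ultimately show ?thesis by simp
    qed
    then have "q * (2 * (d * q + 1)) \<le> q * (t * (s - 1))" by (rule mult_le_mono2)
    then show ?thesis by (simp add: W(2) s_def algebra_simps)
  qed
  then have "q * (card W + 1) \<le> s choose 2" by (simp add: choose_two)
  from sum_independent_sets_le[OF W(1) q0(1) this]
  have sumI: "2 * (\<Sum>f\<in>E \<rightarrow>\<^sub>E {..<q}. card (I f)) \<le> q ^ card E"
    unfolding I_def E_def .
  have sumC: "(\<Sum>f\<in>E \<rightarrow>\<^sub>E {..<q}. card (C f)) \<le> K * q ^ card E"
    using sum_short_cycles_le[OF W q0(1), of k] unfolding C_def E_def K_def .

  \<comment> \<open>The weight \<open>M\<close> makes one averaging argument do both jobs: the mean of the sum is at most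
     \<open>K + M/2 < M\<close>, and a value below \<open>M\<close> leaves no room for an independent set.\<close>
  have "\<exists>f\<in>E \<rightarrow>\<^sub>E {..<q}. card (C f) + M * card (I f) < M"
  proof (rule ccontr)
    assume "\<not> ?thesis"
    then have "M \<le> card (C f) + M * card (I f)" if "f \<in> E \<rightarrow>\<^sub>E {..<q}" for f
      using that not_less by blast
    then have "card (E \<rightarrow>\<^sub>E {..<q}) * M \<le> (\<Sum>f\<in>E \<rightarrow>\<^sub>E {..<q}. card (C f) + M * card (I f))"
      using sum_bounded_below[of "E \<rightarrow>\<^sub>E {..<q}" M] by simp
    also have "\<dots> = (\<Sum>f\<in>E \<rightarrow>\<^sub>E {..<q}. card (C f)) + M * (\<Sum>f\<in>E \<rightarrow>\<^sub>E {..<q}. card (I f))"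
      by (simp add: sum.distrib sum_distrib_left)
    finally have "q ^ card E * M \<le> (\<Sum>f\<in>E \<rightarrow>\<^sub>E {..<q}. card (C f))
        + M * (\<Sum>f\<in>E \<rightarrow>\<^sub>E {..<q}. card (I f))" unfolding cardO .
    moreover have "2 * (M * (\<Sum>f\<in>E \<rightarrow>\<^sub>E {..<q}. card (I f))) \<le> M * q ^ card E"
      using mult_le_mono2[OF sumI, of M] by (simp only: ac_simps)
    ultimately have "2 * (q ^ card E * M) \<le> 2 * (K * q ^ card E) + M * q ^ card E"
      using sumC by linarith
    then have "q ^ card E * (2 * M) \<le> q ^ card E * (2 * K + M)" by (simp add: algebra_simps)
    then show False using q0(1) by (simp add: M_def)
  qed
  then obtain f where f: "f \<in> E \<rightarrow>\<^sub>E {..<q}" "card (C f) + M * card (I f) < M" by blast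
  have "card (I f) = 0" "card (C f) < M" using f(2) by (cases "card (I f)", auto)+
  have finC: "finite (C f)"
    by (rule finite_subset[OF _ finite_lists_length_le[OF W(1), of k]]) (auto simp: C_def)
  have "finite (I f)" using W(1) by (auto simp: I_def)
  with \<open>card (I f) = 0\<close> have I0: "I f = {}" by simp

  define V where "V = W - hd ` C f"
  define Z where "Z = {e\<in>E. f e = 0}"
  show thesis
  proof (rule that[of V s Z])
    show "finite V" using W(1) by (simp add: V_def)
    have "1 * q \<le> s" unfolding s_def t_def by (intro mult_le_mono1) simp
    then show "N \<le> s" using q0(3) by simp
    have "card (hd ` C f) \<le> s"
      using card_image_le[OF finC, of hd] \<open>card (C f) < M\<close> q0(2) \<open>1 * q \<le> s\<close> by simp
    moreover have "card W - card (hd ` C f) \<le> card V"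
      unfolding V_def using finC by (intro diff_card_le_card_Diff) auto
    ultimately show "c * s \<le> card V" by (simp add: W(2) d_def s_def algebra_simps)
    show "card e = 2" if "e \<in> Z" for e using that by (simp add: Z_def E_def)
    show "\<not> cycle_on (\<lambda>u v. {u, v} \<in> Z) xs" if "set xs \<subseteq> V" "length xs \<le> k" for xs
    proof
      assume cyc: "cycle_on (\<lambda>u v. {u, v} \<in> Z) xs"
      then have "xs \<in> C f"
        using cycle_edges_if_cycle_on[OF cyc] that
        by (auto simp: C_def Z_def V_def cycle_on_def)
      moreover have "hd xs \<in> V"
        using that(1) cyc by (cases xs) (auto simp: cycle_on_def)
      ultimately show False by (auto simp: V_def)
    qed
    show "card S < s" if S: "S \<subseteq> V" "\<forall>u\<in>S. \<forall>v\<in>S. {u, v} \<notin> Z" for S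
    proof (rule ccontr)
      assume "\<not> card S < s"
      then obtain T where T: "T \<subseteq> S" "card T = s"
        using obtain_subset_with_card_n[of s S] by (metis not_less)
      have "f e \<noteq> 0" if "e \<in> E" "e \<subseteq> T" for e
      proof -
        obtain u v where "e = {u, v}" using \<open>e \<in> E\<close> by (auto simp: E_def card_2_iff)
        then show ?thesis using S(2) T(1) that by (auto simp: Z_def)
      qed
      then have "T \<in> I f" using T S(1) by (auto simp: I_def V_def)
      then show False using I0 by simp
    qed
  qed
qed

section \<open>Graphs whose complement has no short cycle\<close>

lemma pcas_vertices:
  assumes "pcas u p v"
  shows "pawalk_verts u p = u # map snd p \<and> map fst p @ [v] = u # map snd p"
  using assms
proof (induction p arbitrary: u)
  case (Cons a p)
  then have "pcas (snd a) p v" "fst a = u" by simp_all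
  with Cons.IH[of "snd a"] show ?case by simp
qed simp

lemma successively_map_fst:
  assumes "pcas u p v" "set p \<subseteq> A"
  shows "successively (\<lambda>x y. (x, y) \<in> A) (map fst p @ [v])"
  using assms
proof (induction p arbitrary: u)
  case (Cons a p)
  have "hd (map fst p @ [v]) = snd a" using Cons.prems(1) by (cases p) auto
  then show ?case using Cons by (auto simp: successively_Cons)
qed simp

lemma short_cycle_of_girth_le:
  assumes "ereal_of_enat (girth G) \<le> ereal (real_of_int h)" "parcs G \<subseteq> pverts G \<times> pverts G"
  obtains xs where "cycle_on (\<lambda>u v. (u, v) \<in> parcs G) xs" "set xs \<subseteq> pverts G" "int (length xs) \<le> h"
proof -
  define P where "P = {p. pre_digraph.cycle (with_proj G) p \<and> 3 \<le> length p}"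
  have "P \<noteq> {}"
  proof
    assume "P = {}"
    then have "girth G = \<infinity>" unfolding girth_def P_def[symmetric] by (simp add: top_enat_def)
    then show False using assms by simp
  qed
  then obtain p0 where "p0 \<in> P" by blast
  then have "(INF p\<in>P. enat (length p)) \<in> (\<lambda>p. enat (length p)) ` P"
    by (rule wellorder_InfI[OF imageI])
  then obtain p where p: "p \<in> P" "girth G = enat (length p)"
    unfolding girth_def P_def[symmetric] by auto
  have len: "int (length p) \<le> h" using assms(1) p(2) by simp
  from p(1) obtain u where u: "pre_digraph.awalk (with_proj G) u p u"
      "distinct (tl (pawalk_verts u p))" "3 \<le> length p"
    unfolding P_def by (auto simp: pre_digraph.cycle_def awalk_verts_with_proj_eq)
  have arcs: "set p \<subseteq> parcs G" and cas: "pcas u p u"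
    using u(1) by (auto simp: pre_digraph.awalk_def cas_with_proj_eq)
  \<comment> \<open>The library requires the list of heads to be distinct; for a closed walk it is a rotation of
     the list of tails, which serves as the cycle.\<close>
  have rot: "map fst p @ [u] = u # map snd p" "distinct (map snd p)" "p \<noteq> []"
    using pcas_vertices[OF cas] u by auto
  then have hd: "hd (map fst p) = u" by (cases p) auto
  have "map snd p = rotate1 (map fst p)" using rot(1,3) hd by (cases p) auto
  then have "distinct (map fst p)" using rot(2) by (metis distinct1_rotate)
  moreover have "successively (\<lambda>x y. (x, y) \<in> parcs G) (map fst p)"
      "(last (map fst p), hd (map fst p)) \<in> parcs G"
    using successively_map_fst[OF cas arcs] rot(3) hd by (auto simp: successively_append_iff)
  ultimately have "cycle_on (\<lambda>u v. (u, v) \<in> parcs G) (map fst p)"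
    using u(3) by (simp add: cycle_on_def)
  then show thesis using that len arcs assms(2) by fastforce
qed

lemma cycle_on_map:
  assumes "cycle_on R xs" "inj_on g (set xs)"
    and "\<And>u v. u \<in> set xs \<Longrightarrow> v \<in> set xs \<Longrightarrow> R u v \<Longrightarrow> S (g u) (g v)"
  shows "cycle_on S (map g xs)"
proof -
  have ne: "xs \<noteq> []" using assms(1) by (auto simp: cycle_on_def)
  have "successively (\<lambda>u v. S (g u) (g v)) xs"
    using assms(1,3) by (auto simp: cycle_on_def intro: successively_mono)
  then show ?thesis
    using assms ne by (auto simp: cycle_on_def distinct_map successively_map last_map hd_map)
qed

text \<open>
  Induced copies are what makes this work: nonadjacency in \<open>H\<close> has to carry over to \<open>G\<close>, so
  that a short cycle in the complement of \<open>H\<close> becomes one in the complement of \<open>G\<close>.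
\<close>

lemma free_of_if_no_short_cycle_in_complement:
  assumes girth: "\<And>H. H \<in> \<H> \<Longrightarrow> ereal_of_enat (girth (complement H)) \<le> ereal (real_of_int h)"
    and cyc: "\<And>xs. set xs \<subseteq> pverts G \<Longrightarrow> int (length xs) \<le> h \<Longrightarrow>
                \<not> cycle_on (\<lambda>u v. (u, v) \<in> parcs (complement G)) xs"
  shows "free_of \<H> G"
  unfolding free_of_def
proof
  assume "\<exists>F. \<exists>H\<in>\<H>. induced_subgraph (with_proj F) (with_proj G) \<and>
                  digraph_iso (with_proj F) (with_proj H)"
  then obtain F H f where H: "H \<in> \<H>" and ind: "induced_subgraph (with_proj F) (with_proj G)"
    and iso: "pre_digraph.digraph_isomorphism (with_proj F) f"
    and H_eq: "with_proj H = app_iso f (with_proj F)"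
    unfolding digraph_iso_def by blast
  have FG: "pverts F \<subseteq> pverts G" "\<And>u v. u \<in> pverts F \<Longrightarrow> v \<in> pverts F \<Longrightarrow> (u, v) \<in> parcs G \<Longrightarrow> (u, v) \<in> parcs F"
    using ind by (auto simp: induced_subgraph_def subgraph_def)
  have inj: "inj_on (iso_verts f) (pverts F)"
    using iso by (auto simp: pre_digraph.digraph_isomorphism_def)
  have H_verts: "pverts H = iso_verts f ` pverts F"
    using arg_cong[OF H_eq, of verts] by simp
  have H_arc: "(iso_verts f u, iso_verts f v) \<in> parcs H" if "(u, v) \<in> parcs F" for u v
  proof -
    have "iso_tail f = fst" "iso_head f = snd" "parcs H = iso_arcs f ` parcs F"
      using arg_cong[OF H_eq, of tail] arg_cong[OF H_eq, of head] arg_cong[OF H_eq, of arcs]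
      by (simp_all)
    moreover have "iso_verts f u = iso_tail f (iso_arcs f (u, v))"
        "iso_verts f v = iso_head f (iso_arcs f (u, v))"
      using iso that by (force simp: pre_digraph.digraph_isomorphism_def)+
    ultimately show ?thesis using that by simp
  qed
  define g where "g = the_inv_into (pverts F) (iso_verts f)"
  have g: "g x \<in> pverts F" "iso_verts f (g x) = x" if "x \<in> pverts H" for x
    using that inj H_verts unfolding g_def
    by (auto simp: the_inv_into_f_f)
  obtain xs where xs: "cycle_on (\<lambda>u v. (u, v) \<in> parcs (complement H)) xs" "set xs \<subseteq> pverts H"
      "int (length xs) \<le> h"
    using short_cycle_of_girth_le[OF girth[OF H]] by (auto simp: complement_def)
  have "cycle_on (\<lambda>u v. (u, v) \<in> parcs (complement G)) (map g xs)"
  proof (rule cycle_on_map[OF xs(1)])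
    show "inj_on g (set xs)" using g(2) xs(2) by (metis inj_on_inverseI subsetD)
    fix u v assume uv: "u \<in> set xs" "v \<in> set xs" "(u, v) \<in> parcs (complement H)"
    then have "g u \<noteq> g v" "(g u, g v) \<notin> parcs G"
      using g[of u] g[of v] FG(2)[of "g u" "g v"] H_arc[of "g u" "g v"]
      by (auto simp: complement_def)
    moreover have "g u \<in> pverts G" "g v \<in> pverts G"
      using g(1) uv(1,2) xs(2) FG(1) by blast+
    ultimately show "(g u, g v) \<in> parcs (complement G)" by (simp add: complement_def)
  qed
  moreover have "set (map g xs) \<subseteq> pverts G" using g(1) xs(2) FG(1) by auto
  ultimately show False using cyc[of "map g xs"] xs(3) by simp
qed

text \<open>
  Three vertices of the same colour would be a triangle in the complement.
\<close>

lemma card_le_twice_chromatic_number: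
  fixes G :: "nat pair_pre_digraph"
  assumes "pair_graph G"
    and "\<And>xs. set xs \<subseteq> pverts G \<Longrightarrow> length xs \<le> 3 \<Longrightarrow>
            \<not> cycle_on (\<lambda>u v. (u, v) \<in> parcs (complement G)) xs"
  shows "card (pverts G) \<le> 2 * chromatic_number G"
proof -
  interpret pair_graph G by fact
  \<comment> \<open>Some proper colouring has to exist for the least number of colours to be attained; the
     vertices are numbers and can colour themselves.\<close>
  obtain m where "\<forall>v\<in>pverts G. v < m"
    using pair_finite_verts unfolding finite_nat_set_iff_bounded by blast
  then have "proper_coloring G m (\<lambda>v. v)"
    using pair_no_loops by (fastforce simp: proper_coloring_def)
  then have "\<exists>c. proper_coloring G (chromatic_number G) c"
    unfolding chromatic_number_def
    using LeastI[of "\<lambda>k. \<exists>c. proper_coloring G k c" m] by blast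
  then obtain c where c: "proper_coloring G (chromatic_number G) c" by blast
  have small: "card {v\<in>pverts G. c v = i} \<le> 2" for i
  proof (rule ccontr)
    assume "\<not> ?thesis"
    then obtain T where T: "T \<subseteq> {v\<in>pverts G. c v = i}" "card T = 3"
      using obtain_subset_with_card_n[of 3 "{v\<in>pverts G. c v = i}"] by auto
    then obtain x y z where xyz: "T = {x, y, z}" "x \<noteq> y" "y \<noteq> z" "x \<noteq> z"
      by (auto simp: card_3_iff)
    have "(u, v) \<in> parcs (complement G)" if "u \<in> T" "v \<in> T" "u \<noteq> v" for u v
    proof -
      have "u \<in> pverts G" "v \<in> pverts G" "c u = c v" using that T(1) by auto
      moreover from this have "(u, v) \<notin> parcs G" using c unfolding proper_coloring_def by blast
      ultimately show ?thesis using that(3) by (simp add: complement_def)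
    qed
    then have "cycle_on (\<lambda>u v. (u, v) \<in> parcs (complement G)) [x, y, z]"
      using xyz by (simp add: cycle_on_def)
    then show False using assms(2)[of "[x, y, z]"] T(1) xyz(1) by auto
  qed
  have "pverts G = (\<Union>i<chromatic_number G. {v\<in>pverts G. c v = i})"
    using c by (auto simp: proper_coloring_def)
  then have "card (pverts G) \<le> (\<Sum>i<chromatic_number G. card {v\<in>pverts G. c v = i})"
    by (metis card_UN_le finite_lessThan)
  also have "\<dots> \<le> (\<Sum>i<chromatic_number G. 2)" using small by (rule sum_mono)
  finally show ?thesis by simp
qed

lemma clique_number_bounds:
  assumes "finite (pverts G)" "pverts G \<noteq> {}" "\<And>S. is_clique G S \<Longrightarrow> card S < s"
  shows "0 < clique_number G" "clique_number G < s"
proof -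
  have "{S. is_clique G S} \<subseteq> Pow (pverts G)" by (auto simp: is_clique_def)
  then have "finite {S. is_clique G S}" using assms(1) by (simp add: finite_subset)
  then have fin: "finite {card S |S. is_clique G S}" by simp
  obtain v where "v \<in> pverts G" using assms(2) by blast
  then have v: "card {v} \<in> {card S |S. is_clique G S}"
    by (intro CollectI exI[of _ "{v}"]) (simp add: is_clique_def)
  show "0 < clique_number G" using Max_ge[OF fin v] unfolding clique_number_def by simp
  have "clique_number G \<in> {card S |S. is_clique G S}"
    unfolding clique_number_def using fin v by (intro Max_in) auto
  then show "clique_number G < s" using assms(3) by auto
qed

section \<open>The optimal binding function\<close>

text \<open>
  Boundedness makes the set in the definition finite, so that its \<open>Max\<close> is an upper bound.
\<close>

lemma chromatic_number_le_opt_binding: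
  assumes "chi_bounded (free_graphs \<H>)" "G \<in> free_graphs \<H>"
  shows "chromatic_number G \<le> opt_binding \<H> (clique_number G)"
proof -
  obtain f :: "nat \<Rightarrow> nat" where f: "\<And>G. G \<in> free_graphs \<H> \<Longrightarrow> chromatic_number G \<le> f (clique_number G)"
    using assms(1) unfolding chi_bounded_def by blast
  have "{chromatic_number G' |G'. G' \<in> free_graphs \<H> \<and> clique_number G' = clique_number G}
        \<subseteq> {..f (clique_number G)}"
    using f by fastforce
  then show ?thesis
    unfolding opt_binding_def using assms(2) by (intro Max_ge) (auto intro: finite_subset)
qed

theorem lemma1:
  fixes \<H> :: "'b pair_pre_digraph set" and h :: int
  assumes "\<And>H. H \<in> \<H> \<Longrightarrow> pair_graph H"
    and "\<And>H. H \<in> \<H> \<Longrightarrow> ereal_of_enat (girth (complement H)) \<le> ereal (real_of_int h)"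
    and "chi_bounded (free_graphs \<H>)"
  shows "\<not> (\<exists>a b :: real. \<forall>w>0. real (opt_binding \<H> w) \<le> a * real w + b)"
proof
  assume "\<exists>a b :: real. \<forall>w>0. real (opt_binding \<H> w) \<le> a * real w + b"
  then obtain a b :: real where ab: "\<And>w. w > 0 \<Longrightarrow> real (opt_binding \<H> w) \<le> a * real w + b"
    by blast
  \<comment> \<open>Chosen such that \<open>2 \<bar>a\<bar> \<le> c - 1\<close> and \<open>2 \<bar>b\<bar> < N \<le> s\<close>, hence \<open>2 (\<bar>a\<bar> s + \<bar>b\<bar>) < c s\<close>.\<close>
  define c where "c = nat \<lceil>2 * \<bar>a\<bar>\<rceil> + 1"
  define N where "N = nat \<lceil>2 * \<bar>b\<bar>\<rceil> + 1"
  obtain V :: "nat set" and Z s where V: "finite V" "N \<le> s" "c * s \<le> card V"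
    and Z: "\<And>e. e \<in> Z \<Longrightarrow> card e = 2"
    and cyc: "\<And>xs. set xs \<subseteq> V \<Longrightarrow> length xs \<le> max 3 (nat h) \<Longrightarrow> \<not> cycle_on (\<lambda>u v. {u, v} \<in> Z) xs"
    and ind: "\<And>S. S \<subseteq> V \<Longrightarrow> \<forall>u\<in>S. \<forall>v\<in>S. {u, v} \<notin> Z \<Longrightarrow> card S < s"
    by (rule large_girth_small_independence[of N c "max 3 (nat h)"]) (rule that)
  define G where "G = \<lparr>pverts = V, parcs = {(u, v). u \<in> V \<and> v \<in> V \<and> u \<noteq> v \<and> {u, v} \<notin> Z}\<rparr>"
  have "finite (parcs G)"
    by (rule finite_subset[of _ "V \<times> V"]) (use V(1) in \<open>auto simp: G_def\<close>)
  then have G: "pair_graph G"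
    using V(1) by unfold_locales (auto simp: G_def symmetric_def sym_def insert_commute)
  have "0 < s" "0 < c * s" using V(2) by (auto simp: N_def c_def)
  then have "V \<noteq> {}" using V(3) by auto
  have "{u} \<notin> Z" for u using Z[of "{u}"] by auto
  have no_cycle: "\<not> cycle_on (\<lambda>u v. (u, v) \<in> parcs (complement G)) xs"
    if "set xs \<subseteq> pverts G" "length xs \<le> max 3 (nat h)" for xs
  proof
    assume "cycle_on (\<lambda>u v. (u, v) \<in> parcs (complement G)) xs"
    then have "cycle_on (\<lambda>u v. {u, v} \<in> Z) (map (\<lambda>x. x) xs)"
      by (rule cycle_on_map) (auto simp: complement_def G_def)
    then show False using cyc[of xs] that by (simp add: G_def)
  qed
  have "free_of \<H> G"
    using assms(2) no_cycle by (intro free_of_if_no_short_cycle_in_complement[of \<H> h]) auto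
  then have free: "G \<in> free_graphs \<H>"
    using G \<open>V \<noteq> {}\<close> by (simp add: free_graphs_def G_def)
  have "card S < s" if "is_clique G S" for S
    using that \<open>\<And>u. {u} \<notin> Z\<close>
    by (intro ind) (auto simp: is_clique_def G_def, metis insert_absorb2)
  then have w: "0 < clique_number G" "clique_number G < s"
    using clique_number_bounds[of G s] V(1) \<open>V \<noteq> {}\<close> by (simp_all add: G_def)
  have "c * s \<le> 2 * chromatic_number G"
    using V(3) card_le_twice_chromatic_number[OF G] no_cycle by (force simp: G_def)
  also have "\<dots> \<le> 2 * opt_binding \<H> (clique_number G)"
    using chromatic_number_le_opt_binding[OF assms(3) free] by simp
  finally have "real (c * s) \<le> 2 * real (opt_binding \<H> (clique_number G))"
    by (metis of_nat_le_iff of_nat_mult of_nat_numeral)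
  also have "\<dots> \<le> 2 * (a * real (clique_number G) + b)" using ab[OF w(1)] by simp
  also have "\<dots> \<le> 2 * \<bar>a\<bar> * real s + 2 * \<bar>b\<bar>"
  proof -
    have "a * real (clique_number G) \<le> \<bar>a\<bar> * real s" using w(2) by (intro mult_mono) auto
    then show ?thesis using abs_ge_self[of b] by (simp only: distrib_left mult.assoc)
  qed
  also have "\<dots> < (real c - 1) * real s + real s"
  proof (rule add_le_less_mono)
    have "2 * \<bar>a\<bar> \<le> real c - 1" unfolding c_def by linarith
    then show "2 * \<bar>a\<bar> * real s \<le> (real c - 1) * real s" by (rule mult_right_mono) simp
    show "2 * \<bar>b\<bar> < real s" using V(2) unfolding N_def by linarith
  qed
  finally show False by (simp add: algebra_simps)
qed

end
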